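(* Let $e_{\mathbb R}$ be a fixed even integer with $-18\le e_{\mathbb R}\le 20$, let $(w_g)_{g\ge 0}$ be the corresponding sequence of signed counts of real rational curves on primitively polarized real $K3$ surfaces whose real part has Euler characteristic $e_{\mathbb R}$, and let $(c_g)_{g\ge 0}$ be the sequence of counts of complex rational curves. The following congruences hold: i) $w_g\equiv c_g\pmod 2$ for any $g\ge 1$, and $w_g\equiv c_g\equiv 0\pmod 2$ for every $g$ with $g\not\equiv 0\pmod 8$. ii) If $e_{\mathbb R}\equiv 0\pmod 4$, then $w_g\equiv c_g\pmod 4$ for any $g\ge 1$, and if in addition $g\not\equiv 0\pmod 4$, then $w_g\equiv c_g\equiv 0\pmod 4$. iii) If $e_{\mathbb R}\equiv 0\pmod 8$, then $w_g\equiv c_g\pmod 8$ for any $g\ge 1$, and if in addition $g\not\equiv 0\pmod 2$, then $w_g\equiv c_g\equiv 0\pmod 8$. iv) If $e_{\mathbb R}\equiv 0\pmod 3$ and $g\not\equiv 0\pmod 3$, then $w_g\equiv c_g\equiv 0\pmod 3$.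
   Context: Let $X$ be a generic real $K3$ surface admitting a complete real $g$-dimensional linear system of curves of genus $g$; if $g\ge 2$, assume in addition that $X$ has Picard rank $1$ and that the curves in the linear system belong to a primitive divisor class. Genericity ensures that all rational curves in the linear system are nodal. Let $c_g$ be the number of complex rational curves in this linear system, and let $w_g=n_+-n_-$ be the number of real rational curves in it counted with Welschinger sign: $n_+$ (resp. $n_-$) is the number of real rational curves in the system having an even (resp. odd) number of real solitary points. Let $e_{\mathbb R}$ be the Euler characteristic of the real part $X_{\mathbb R}$ (always even, between $-18$ and $20$) and $e_{\mathbb C}=24$ the Euler characteristic of $X$. It is known (taken as given) that $c_g$ depends only on $g$, that $w_g$ depends only on $g$ and $e_{\mathbb R}$, and that $$\sum_{g\ge 0} c_g q^g=\prod_{s\ge 1}\frac{1}{(1-q^{s})^{e_{\mathbb C}}},\qquad \sum_{g\ge 0} w_g q^g=\prod_{r\ge 1}\frac{1}{(1+q^r)^{e_{\mathbb R}}}\prod_{s\ge 1}\frac{1}{(1-q^{2s})^{\frac{e_{\mathbb C}-e_{\mathbb R}}{2}}}.$$ For fixed $e_{\mathbb R}$, $(w_g)_{g\ge0}$ denotes the sequence of coefficients of the second series. *)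

theory Defs
  imports
    "HOL-Analysis.Infinite_Products"
    "HOL-Computational_Algebra.Formal_Power_Series"
    "HOL-Number_Theory.Cong"
begin

text \<open>
  The counts of complex rational curves, and the signed counts of real rational curves, are
  entered through their generating series.  The products are infinite products with respect to
  the usual topology on formal power series.  They are formed over the rationals so that the
  inverses and integer powers of the library apply; all coefficients are integers (see below).
  The index starts at 0, so \<open>Suc s\<close> is the index \<open>s \<ge> 1\<close> of the usual notation.
\<close>

abbreviation euler_complex_K3 :: int where
  "euler_complex_K3 \<equiv> 24"

definition complex_curves_gf :: "rat fps" where
  "complex_curves_gf = (\<Prod>s. inverse ((1 - fps_X ^ Suc s) powi euler_complex_K3))"

text \<open>
  The Euler characteristic \<open>e\<close> of the real part may be negative, hence the integer powers.
  It is only used for even \<open>e\<close>, where the \<open>div\<close> in the exponent is exact.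
\<close>

definition real_curves_gf :: "int \<Rightarrow> rat fps" where
  "real_curves_gf e =
     (\<Prod>r. inverse ((1 + fps_X ^ Suc r) powi e)) *
     (\<Prod>s. inverse ((1 - fps_X ^ (2 * Suc s)) powi ((euler_complex_K3 - e) div 2)))"

definition complex_curve_counts :: "(nat \<Rightarrow> int) \<Rightarrow> bool" where
  "complex_curve_counts c \<longleftrightarrow> Abs_fps (\<lambda>g. rat_of_int (c g)) = complex_curves_gf"

definition real_curve_counts :: "int \<Rightarrow> (nat \<Rightarrow> int) \<Rightarrow> bool" where
  "real_curve_counts e w \<longleftrightarrow> Abs_fps (\<lambda>g. rat_of_int (w g)) = real_curves_gf e"

text \<open>
  The infinite products converge and have integer coefficients, so each of the two predicates
  is satisfied by exactly one sequence.
\<close>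

definition int_unit :: "nat \<Rightarrow> rat fps \<Rightarrow> bool" where
  "int_unit m f \<longleftrightarrow> fps_nth f 0 = 1 \<and> (\<forall>n. fps_nth f n \<in> \<int>) \<and>
     (\<forall>n. 0 < n \<and> n \<le> m \<longrightarrow> fps_nth f n = 0)"

lemma int_unit_mult:
  assumes "int_unit m f" "int_unit m g"
  shows "int_unit m (f * g)"
proof -
  have "fps_nth (f * g) n = 0" if "0 < n" "n \<le> m" for n
  proof -
    have "fps_nth f i * fps_nth g (n - i) = 0" if "i \<le> n" for i
      using that \<open>0 < n\<close> \<open>n \<le> m\<close> assms by (cases "i = 0") (auto simp: int_unit_def)
    thus ?thesis unfolding fps_mult_nth by (intro sum.neutral) auto
  qed
  thus ?thesis using assms by (auto simp: int_unit_def fps_mult_nth intro!: Ints_sum Ints_mult)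
qed

lemma int_unit_1: "int_unit m 1"
  by (auto simp: int_unit_def)

lemma int_unit_power: "int_unit m f \<Longrightarrow> int_unit m (f ^ k)"
  by (induction k) (auto intro: int_unit_mult int_unit_1)

lemma int_unit_inverse:
  assumes "int_unit m f"
  shows "int_unit m (inverse f)"
proof -
  have f0: "fps_nth f 0 = 1" and fint: "\<And>n. fps_nth f n \<in> \<int>"
    and fz: "\<And>n. 0 < n \<Longrightarrow> n \<le> m \<Longrightarrow> fps_nth f n = 0"
    using assms by (auto simp: int_unit_def)
  have rec: "fps_nth (inverse f) n = - (\<Sum>i = 1..n. fps_nth f i * fps_nth (inverse f) (n - i))"
    if "0 < n" for n
    using that f0 by (cases n) (simp_all add: fps_inverse_def)
  have "fps_nth (inverse f) n \<in> \<int>" for n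
  proof (induction n rule: less_induct)
    case (less n)
    show ?case
    proof (cases "n = 0")
      case False
      thus ?thesis using less fint
        by (subst rec) (auto intro!: Ints_sum Ints_mult Ints_minus)
    qed (simp add: f0)
  qed
  moreover have "fps_nth (inverse f) n = 0" if "0 < n" "n \<le> m" for n
    using that fz by (subst rec) auto
  ultimately show ?thesis by (auto simp: int_unit_def f0)
qed

lemma int_unit_powi: "int_unit m f \<Longrightarrow> int_unit m (f powi k)"
  by (auto simp: power_int_def intro: int_unit_power int_unit_inverse)

lemma int_unit_plus_X: "m < k \<Longrightarrow> int_unit m (1 + fps_X ^ k)"
  and int_unit_minus_X: "m < k \<Longrightarrow> int_unit m (1 - fps_X ^ k)"
  by (auto simp: int_unit_def fps_X_power_nth)

lemma int_unit_prod:
  assumes "\<And>k. int_unit k (f k)"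
  shows "f has_prod (\<Prod>k. f k)" and "int_unit 0 (\<Prod>k. f k)"
proof -
  define P where "P = Abs_fps (\<lambda>n. fps_nth (\<Prod>k\<le>n. f k) n)"
  have weaken: "int_unit 0 (f k)" for k using assms[of k] by (auto simp: int_unit_def)
  have fin: "int_unit 0 (\<Prod>k\<le>n. f k)" for n
    by (induction n) (auto intro: int_unit_mult weaken)
  have step: "fps_nth (\<Prod>k\<le>N. f k) n = fps_nth P n" if "n \<le> N" for n N
    using that
  proof (induction N rule: dec_induct)
    case base
    show ?case by (simp add: P_def)
  next
    case (step N)
    have "fps_nth (\<Prod>k\<le>Suc N. f k) n = (\<Sum>i=0..n. fps_nth (\<Prod>k\<le>N. f k) i * fps_nth (f (Suc N)) (n - i))"
      by (simp add: fps_mult_nth)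
    also have "\<dots> = (\<Sum>i=0..n. if i = n then fps_nth (\<Prod>k\<le>N. f k) n else 0)"
      using assms[of "Suc N"] step(1) by (intro sum.cong) (auto simp: int_unit_def)
    also have "\<dots> = fps_nth (\<Prod>k\<le>N. f k) n" by simp
    finally show ?case using step by simp
  qed
  have lim: "(\<lambda>n. \<Prod>k\<le>n. f k) \<longlonglongrightarrow> P"
    by (rule tendsto_fpsI) (use step in \<open>auto simp: eventually_at_top_linorder\<close>)
  have P: "int_unit 0 P"
    using fin by (simp add: int_unit_def P_def del: prod.atMost_Suc) (use fin[of 0] in \<open>simp add: int_unit_def\<close>)
  hence "P \<noteq> 0" by (auto simp: int_unit_def)
  with lim have hp: "f has_prod P" by (auto simp: has_prod_def raw_has_prod_def)
  have "P = (\<Prod>k. f k)" by (rule has_prod_unique[OF hp])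
  with hp P show "f has_prod (\<Prod>k. f k)" "int_unit 0 (\<Prod>k. f k)" by simp_all
qed

lemmas int_unit_factor =
  int_unit_inverse[OF int_unit_powi[OF int_unit_plus_X]]
  int_unit_inverse[OF int_unit_powi[OF int_unit_minus_X]]

lemma complex_curves_gf_has_prod:
  "(\<lambda>s. inverse ((1 - fps_X ^ Suc s) powi 24)) has_prod complex_curves_gf"
  unfolding complex_curves_gf_def
  by (rule int_unit_prod(1)) (rule int_unit_factor, simp)

lemma real_curves_gf_has_prod:
  "(\<lambda>r. inverse ((1 + fps_X ^ Suc r :: rat fps) powi e)) has_prod
     (\<Prod>r. inverse ((1 + fps_X ^ Suc r) powi e))"
  "(\<lambda>s. inverse ((1 - fps_X ^ (2 * Suc s) :: rat fps) powi ((24 - e) div 2))) has_prod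
     (\<Prod>s. inverse ((1 - fps_X ^ (2 * Suc s)) powi ((24 - e) div 2)))"
  by (rule int_unit_prod(1), rule int_unit_factor, simp)+

lemma int_unit_ex1:
  assumes "int_unit 0 F"
  shows "\<exists>!c. Abs_fps (\<lambda>g. rat_of_int (c g)) = F"
proof -
  have "\<forall>g. \<exists>z. fps_nth F g = rat_of_int z"
    using assms by (auto simp: int_unit_def elim!: Ints_cases)
  then obtain c where c: "fps_nth F g = rat_of_int (c g)" for g by metis
  show ?thesis
    by (rule ex1I[of _ c]) (auto simp: fps_eq_iff c)
qed

lemma ex1_complex_curve_counts: "\<exists>!c. complex_curve_counts c"
  unfolding complex_curve_counts_def complex_curves_gf_def
  by (intro int_unit_ex1 int_unit_prod(2) int_unit_factor) simp

lemma ex1_real_curve_counts: "\<exists>!w. real_curve_counts e w"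
  unfolding real_curve_counts_def real_curves_gf_def
  by (intro int_unit_ex1 int_unit_mult int_unit_prod(2) int_unit_factor) simp_all

end

theory Submission
  imports Defs
begin

text \<open>
  Write \<open>h = e / 2\<close>.  Factor by factor, the generating series of the signed counts is that of the
  complex counts times a correction: with \<open>x = q ^ r\<close>,
  \<open>(1 + x) ^ (-e) * (1 - x\<^sup>2) ^ (h - 12) = (1 - x) ^ (-24) * ((1 - x) / (1 + x)) ^ (12 + h)\<close>.
  Every congruence is read off from this identity.

  Since \<open>(1 - x) / (1 + x) = 1 - 2 x / (1 + x)\<close>, repeated squaring shows that its first, second
  and fourth powers are congruent to \<open>1\<close> modulo \<open>2\<close>, \<open>4\<close> and \<open>8\<close>.  So the correction is
  congruent to \<open>1\<close> modulo \<open>2\<close> always, modulo \<open>4\<close> if \<open>4\<close> divides \<open>e\<close>, and modulo \<open>8\<close> if \<open>8\<close>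
  divides \<open>e\<close>, because \<open>12 + h\<close> is then a multiple of \<open>2\<close> or \<open>4\<close>.  Hence \<open>w g\<close> and \<open>c g\<close> are
  congruent to that modulus.

  The vanishing of \<open>c g\<close> comes from the coefficients of
  \<open>(1 - x) ^ 8 = 1 - 8 x + 28 x\<^sup>2 - 56 x\<^sup>3 + 70 x\<^sup>4 - 56 x\<^sup>5 + 28 x\<^sup>6 - 8 x\<^sup>7 + x\<^sup>8\<close>:
  modulo \<open>2\<close>, \<open>4\<close>, \<open>8\<close> it is a polynomial in \<open>x\<^sup>8\<close>, \<open>x\<^sup>4\<close>, \<open>x\<^sup>2\<close>, and \<open>24\<close> is a multiple of \<open>8\<close>.
  Modulo \<open>3\<close>, the cubes of \<open>1 - x\<close> and \<open>1 + x\<close> are polynomials in \<open>x\<^sup>3\<close>; \<open>3\<close> divides \<open>24\<close>, and it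
  divides \<open>12 + h\<close> when it divides \<open>e\<close>, so both series are power series in \<open>q\<^sup>3\<close> modulo \<open>3\<close>.

  All of this takes place in the rings \<open>\<int>[[q\<^sup>d]] + m \<int>[[q]]\<close>, here \<open>power_series_mod d m\<close>, which
  contain the inverses of their elements with constant term \<open>1\<close>.  For \<open>d = 0\<close> the ring is
  \<open>\<int> + m \<int>[[q]]\<close>, so that the congruences to \<open>1\<close> are membership statements too.  A given
  coefficient of an infinite product is already that of a finite partial product
  (\<open>nth_prodinf_eventually\<close>), so the infinite products need no further treatment.
\<close>

section \<open>Power series in a power of the variable modulo an integer\<close>

text \<open>The values allowed for the coefficient of \<open>q\<^sup>n\<close> in \<open>\<int>[[q\<^sup>d]] + m \<int>[[q]]\<close>.  They are taken as
  rational numbers so that power series have inverses.\<close>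

definition graded_ints :: "nat \<Rightarrow> int \<Rightarrow> nat \<Rightarrow> rat set" where
  "graded_ints d m n = {of_int k |k. d dvd n \<or> m dvd k}"

text \<open>The ring \<open>\<int>[[q\<^sup>d]] + m \<int>[[q]]\<close>: the integral power series that are series in \<open>q\<^sup>d\<close>
  modulo \<open>m\<close>.  As only \<open>0\<close> is divisible by \<open>0\<close>, the case \<open>d = 0\<close> consists of the series that
  are constant modulo \<open>m\<close>.\<close>

definition power_series_mod :: "nat \<Rightarrow> int \<Rightarrow> rat fps set" where
  "power_series_mod d m = {F. \<forall>n. fps_nth F n \<in> graded_ints d m n}"

lemma graded_ints_of_int_iff: "of_int k \<in> graded_ints d m n \<longleftrightarrow> d dvd n \<or> m dvd k"
  by (auto simp: graded_ints_def)

lemma graded_ints_add: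
  assumes "a \<in> graded_ints d m n" "b \<in> graded_ints d m n"
  shows "a + b \<in> graded_ints d m n"
proof -
  obtain k l where "a = of_int k" "b = of_int l" "d dvd n \<or> m dvd k" "d dvd n \<or> m dvd l"
    using assms by (auto simp: graded_ints_def)
  thus ?thesis using graded_ints_of_int_iff[of "k + l" d m n] by auto
qed

text \<open>If \<open>d\<close> does not divide \<open>i + j\<close>, it fails to divide one of the two, and that factor
  is a multiple of \<open>m\<close>.\<close>

lemma graded_ints_mult:
  assumes "a \<in> graded_ints d m i" "b \<in> graded_ints d m j"
  shows "a * b \<in> graded_ints d m (i + j)"
proof -
  obtain k l where "a = of_int k" "b = of_int l" "d dvd i \<or> m dvd k" "d dvd j \<or> m dvd l"
    using assms by (auto simp: graded_ints_def)
  thus ?thesis using graded_ints_of_int_iff[of "k * l" d m "i + j"] by auto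
qed

lemma graded_ints_uminus: "a \<in> graded_ints d m n \<Longrightarrow> - a \<in> graded_ints d m n"
  using graded_ints_mult[of "- 1" d m 0 a n] graded_ints_of_int_iff[of "- 1" d m 0] by simp

lemma graded_ints_sum:
  "(\<And>i. i \<in> I \<Longrightarrow> f i \<in> graded_ints d m n) \<Longrightarrow> sum f I \<in> graded_ints d m n"
proof (induction I rule: infinite_finite_induct)
  case (insert i I)
  thus ?case by (simp add: graded_ints_add)
qed (use graded_ints_of_int_iff[of 0] in auto)

lemma power_series_mod_add:
  "F \<in> power_series_mod d m \<Longrightarrow> G \<in> power_series_mod d m \<Longrightarrow> F + G \<in> power_series_mod d m"
  by (auto simp: power_series_mod_def intro: graded_ints_add)

lemma power_series_mod_uminus: "F \<in> power_series_mod d m \<Longrightarrow> - F \<in> power_series_mod d m"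
  by (auto simp: power_series_mod_def intro: graded_ints_uminus)

lemma power_series_mod_mult:
  assumes "F \<in> power_series_mod d m" "G \<in> power_series_mod d m"
  shows "F * G \<in> power_series_mod d m"
proof -
  have "fps_nth F i * fps_nth G (n - i) \<in> graded_ints d m n" if "i \<le> n" for i n
    using graded_ints_mult[of "fps_nth F i" d m i "fps_nth G (n - i)" "n - i"] assms that
    by (auto simp: power_series_mod_def)
  thus ?thesis
    by (auto simp: power_series_mod_def fps_mult_nth intro!: graded_ints_sum)
qed

lemma power_series_mod_of_int: "of_int k \<in> power_series_mod d m"
  using graded_ints_of_int_iff[of k d m 0] graded_ints_of_int_iff[of 0 d m]
  by (auto simp: power_series_mod_def fps_of_int[symmetric] fps_const_def)

lemma power_series_mod_1: "1 \<in> power_series_mod d m"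
  using power_series_mod_of_int[of 1] by simp

lemma power_series_mod_power: "F \<in> power_series_mod d m \<Longrightarrow> F ^ k \<in> power_series_mod d m"
  by (induction k) (auto intro: power_series_mod_mult power_series_mod_1)

lemma power_series_mod_prod:
  "(\<And>i. i \<in> I \<Longrightarrow> f i \<in> power_series_mod d m) \<Longrightarrow> prod f I \<in> power_series_mod d m"
  by (induction I rule: infinite_finite_induct)
     (auto intro: power_series_mod_mult power_series_mod_1)

text \<open>The recursion for the coefficients of the inverse divides only by the constant term.\<close>

lemma power_series_mod_inverse:
  assumes F: "F \<in> power_series_mod d m" and F0: "fps_nth F 0 = 1"
  shows "inverse F \<in> power_series_mod d m"
proof -
  have rec: "fps_nth (inverse F) n = - (\<Sum>i = 1..n. fps_nth F i * fps_nth (inverse F) (n - i))"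
    if "0 < n" for n
    using that F0 by (cases n) (simp_all add: fps_inverse_def)
  have "fps_nth (inverse F) n \<in> graded_ints d m n" for n
  proof (induction n rule: less_induct)
    case (less n)
    show ?case
    proof (cases "n = 0")
      case True
      thus ?thesis using F0 graded_ints_of_int_iff[of 1 d m 0] by simp
    next
      case False
      have "fps_nth F i * fps_nth (inverse F) (n - i) \<in> graded_ints d m n" if "i \<in> {1..n}" for i
        using graded_ints_mult[of "fps_nth F i" d m i "fps_nth (inverse F) (n - i)" "n - i"]
          less[of "n - i"] F that by (auto simp: power_series_mod_def)
      thus ?thesis using False by (auto simp: rec intro!: graded_ints_uminus graded_ints_sum)
    qed
  qed
  thus ?thesis by (simp add: power_series_mod_def)
qed

text \<open>The case \<open>d = 1\<close> is the ring of all integral power series, for any modulus.\<close>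

lemma power_series_mod_integral: "F \<in> power_series_mod d m \<Longrightarrow> F \<in> power_series_mod 1 n"
proof -
  have "graded_ints d m k \<subseteq> graded_ints 1 n k" for k by (auto simp: graded_ints_def)
  thus "F \<in> power_series_mod d m \<Longrightarrow> F \<in> power_series_mod 1 n"
    unfolding power_series_mod_def by blast
qed

lemma power_series_mod_of_int_mult:
  assumes "F \<in> power_series_mod 1 m" "m dvd k"
  shows "of_int k * F \<in> power_series_mod d m"
proof -
  have "of_int k * fps_nth F n \<in> graded_ints d m n" for n
  proof -
    obtain l where "fps_nth F n = of_int l"
      using assms(1) by (auto simp: power_series_mod_def graded_ints_def)
    thus ?thesis using graded_ints_of_int_iff[of "k * l" d m n] assms(2) by simp
  qed
  thus ?thesis by (simp add: power_series_mod_def fps_of_int[symmetric])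
qed

lemma power_series_mod_X_power: "d dvd n \<Longrightarrow> fps_X ^ n \<in> power_series_mod d m"
  using graded_ints_of_int_iff[of 0 d m] graded_ints_of_int_iff[of 1 d m]
  by (auto simp: power_series_mod_def fps_X_power_nth)

lemma power_series_mod_monomial:
  assumes "d dvd j \<or> m dvd k"
  shows "of_int k * (fps_X ^ s) ^ j \<in> power_series_mod d m"
proof (cases "d dvd j")
  case True
  thus ?thesis
    by (auto intro!: power_series_mod_mult power_series_mod_of_int power_series_mod_X_power
             simp flip: power_mult)
next
  case False
  thus ?thesis using assms
    by (auto intro!: power_series_mod_of_int_mult power_series_mod_X_power simp flip: power_mult)
qed

text \<open>The criterion that makes the vanishing statements a matter of inspecting one row of
  Pascal's triangle.\<close>

lemma binomial_power_series_mod: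
  assumes "\<And>j. j \<le> N \<Longrightarrow> d dvd j \<or> m dvd int (N choose j)"
  shows "(1 + of_int a * fps_X ^ s) ^ N \<in> power_series_mod d m"
proof -
  have "(1 + of_int a * fps_X ^ s :: rat fps) ^ N =
          (\<Sum>j\<le>N. of_int (int (N choose j) * a ^ j) * (fps_X ^ s) ^ j)"
    by (subst add.commute, subst binomial_ring) (simp add: power_mult_distrib mult.assoc)
  also have "\<dots> \<in> power_series_mod d m"
  proof -
    have "of_int (int (N choose j) * a ^ j) * (fps_X ^ s) ^ j \<in> power_series_mod d m"
      if "j \<le> N" for j
      using assms[OF that] by (intro power_series_mod_monomial) auto
    hence "fps_nth (of_int (int (N choose j) * a ^ j) * (fps_X ^ s) ^ j) n \<in> graded_ints d m n"
      if "j \<le> N" for j n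
      using that unfolding power_series_mod_def by blast
    thus ?thesis
      unfolding power_series_mod_def
      by (auto simp: fps_sum_nth simp del: of_int_mult intro!: graded_ints_sum)
  qed
  finally show ?thesis .
qed

section \<open>Comparison of the factors of the two products\<close>

text \<open>The Cayley transform of \<open>q\<^sup>s\<close>; a power of it is the ratio of corresponding factors of the
  real and the complex generating series.\<close>

definition cayley :: "nat \<Rightarrow> rat fps" where
  "cayley s = (1 - fps_X ^ s) * inverse (1 + fps_X ^ s)"

lemma nth_0_cayley: "s > 0 \<Longrightarrow> fps_nth (cayley s) 0 = 1"
  by (simp add: cayley_def)

text \<open>Formal power series do not form a field, so the usual laws of integer exponents are not at
  hand.  A difference of naturals as exponent, cleared by a power of the base, covers both signs
  at once.\<close>

lemma inverse_powi_diff_mult: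
  fixes F :: "rat fps"
  assumes "fps_nth F 0 = 1"
  shows "inverse (F powi (int a - int b)) * F ^ a = F ^ b"
proof (cases "b \<le> a")
  case True
  then obtain k where k: "a = b + k" using le_Suc_ex by blast
  have "inverse (F ^ k) * F ^ k = 1" using assms by (intro inverse_mult_eq_1) (simp add: fps_power_zeroth)
  thus ?thesis by (simp add: k power_add mult.left_commute)
next
  case False
  then obtain k where k: "b = a + k" "k > 0" using less_imp_add_positive[of a b] by auto
  have "F powi (int a - int b) = inverse (F ^ k)"
    using k by (simp add: power_int_def fps_inverse_power)
  moreover have "inverse (inverse (F ^ k)) = F ^ k"
    using assms by (intro fps_inverse_idempotent) (simp add: fps_power_zeroth)
  ultimately show ?thesis by (simp add: k power_add mult.commute)
qed

text \<open>Put \<open>p = 1 + x\<close>, \<open>q = 1 - x\<close>, \<open>a = 12 + h\<close>, \<open>b = 12 - h\<close>, so that \<open>2 h = a - b\<close> and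
  \<open>a + b = 24\<close>.  The two sides are \<open>p\<^bsup>b-a\<^esup> (p q)\<^bsup>-b\<^esup>\<close> and \<open>q\<^bsup>-a-b\<^esup> (q / p)\<^bsup>a\<^esup>\<close>, both equal to
  \<open>p\<^bsup>-a\<^esup> q\<^bsup>-b\<^esup>\<close>.  The bounds on \<open>h\<close> make \<open>a\<close> and \<open>b\<close> natural numbers.\<close>

lemma real_factor_eq:
  fixes h :: int
  assumes "s > 0" "-12 \<le> h" "h \<le> 12"
  shows "inverse ((1 + fps_X ^ s) powi (2 * h)) * inverse ((1 - fps_X ^ (2 * s)) powi (12 - h)) =
         inverse ((1 - fps_X ^ s) powi 24) * cayley s ^ nat (12 + h)"
proof -
  define a b where "a = nat (12 + h)" and "b = nat (12 - h)"
  define p q where "p = (1 + fps_X ^ s :: rat fps)" and "q = (1 - fps_X ^ s :: rat fps)"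
  have p0: "fps_nth p 0 = 1" and q0: "fps_nth q 0 = 1"
    using assms(1) by (auto simp: p_def q_def)
  have exps: "2 * h = int a - int b" "12 - h = int b - int 0" "a + b = 24"
    using assms by (auto simp: a_def b_def)
  have pq: "1 - fps_X ^ (2 * s) = p * q"
    by (simp add: p_def q_def algebra_simps flip: power_add mult_2)
  define A B C where "A = inverse (p powi (2 * h))" and "B = inverse ((p * q) powi (12 - h))"
    and "C = inverse (q powi 24)"
  have A: "A * p ^ a = p ^ b"
    unfolding A_def exps by (rule inverse_powi_diff_mult[OF p0])
  have B: "B * (p * q) ^ b = 1"
    using inverse_powi_diff_mult[of "p * q" b 0] p0 q0 by (simp add: B_def exps)
  have C: "C * q ^ (a + b) = 1"
    using inverse_powi_diff_mult[of q 24 0] q0 by (simp add: C_def exps)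
  have "(A * B * p ^ a) * q ^ b = (A * p ^ a) * (B * q ^ b)"
    by (simp add: mult_ac)
  also have "\<dots> = B * (p * q) ^ b" by (simp add: A power_mult_distrib mult_ac)
  also have "\<dots> = (C * q ^ a) * q ^ b" using B C by (simp add: power_add mult_ac)
  finally have AB: "A * B * p ^ a = C * q ^ a"
    using mult_right_cancel[of "q ^ b" "A * B * p ^ a" "C * q ^ a"] q0 by fastforce
  have pinv: "p ^ a * inverse p ^ a = 1"
    using inverse_mult_eq_1'[of p] p0 by (simp flip: power_mult_distrib)
  have "A * B = A * B * p ^ a * inverse p ^ a" by (simp add: mult.assoc pinv)
  also have "\<dots> = C * cayley s ^ a"
    unfolding AB by (simp add: cayley_def power_mult_distrib mult.assoc flip: p_def q_def)
  finally show ?thesis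
    by (simp add: A_def B_def C_def a_def pq flip: p_def q_def)
qed

section \<open>Congruences of the factors\<close>

lemma one_minus_X_power_power_series_mod:
  assumes "\<And>j. j \<le> N \<Longrightarrow> d dvd j \<or> m dvd int (N choose j)"
  shows "(1 - fps_X ^ s) ^ N \<in> power_series_mod d m"
  using binomial_power_series_mod[OF assms, where a = "- 1"] by simp

lemma one_plus_X_power_power_series_mod:
  assumes "\<And>j. j \<le> N \<Longrightarrow> d dvd j \<or> m dvd int (N choose j)"
  shows "(1 + fps_X ^ s) ^ N \<in> power_series_mod d m"
  using binomial_power_series_mod[OF assms, where a = 1] by simp

lemma binomial_8_dvd:
  assumes "(d, m) \<in> {(8, 2), (4, 4), (2, 8)}" "j \<le> 8"
  shows "d dvd j \<or> m dvd int (8 choose j)"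
proof -
  have "8 choose 1 = 8" "8 choose 2 = 28" "8 choose 3 = 56" "8 choose 4 = 70"
       "8 choose 5 = 56" "8 choose 6 = 28" "8 choose 7 = 8"
    by (simp_all add: numeral_eq_Suc)
  moreover have "j \<in> {0, 1, 2, 3, 4, 5, 6, 7, 8}"
    using assms(2) by auto
  ultimately show ?thesis using assms(1) by auto
qed

lemma binomial_3_dvd:
  assumes "j \<le> 3"
  shows "3 dvd j \<or> 3 dvd int (3 choose j)"
proof -
  have "3 choose 1 = 3" "3 choose 2 = 3"
    by (simp_all add: numeral_eq_Suc)
  moreover have "j \<in> {0, 1, 2, 3}"
    using assms by auto
  ultimately show ?thesis by auto
qed

lemma complex_factor_power_series_mod:
  assumes "s > 0" "(d, m) \<in> {(8, 2), (4, 4), (2, 8), (3, 3)}"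
  shows "inverse ((1 - fps_X ^ s) powi 24) \<in> power_series_mod d m"
proof (rule power_series_mod_inverse)
  show "(1 - fps_X ^ s) powi 24 \<in> power_series_mod d m"
  proof (cases "(d, m) = (3, 3)")
    case True
    have "((1 - fps_X ^ s) ^ 3) ^ 8 \<in> power_series_mod 3 3"
      by (intro power_series_mod_power one_minus_X_power_power_series_mod binomial_3_dvd)
    thus ?thesis using True by simp
  next
    case False
    hence "((1 - fps_X ^ s) ^ 8) ^ 3 \<in> power_series_mod d m"
      using assms(2)
      by (intro power_series_mod_power one_minus_X_power_power_series_mod binomial_8_dvd) auto
    thus ?thesis by simp
  qed
qed (use assms(1) in \<open>simp add: fps_power_zeroth_eq_one\<close>)

text \<open>Writing the base as \<open>1 + 2 z\<close>, its square is \<open>1 + 4 z (z + 1)\<close>, and the square of that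
  is \<open>1 + 8 t\<close> with \<open>t\<close> integral.\<close>

lemma cayley_power_cong_1:
  assumes s: "s > 0" and km: "(k, m) \<in> {(1, 2), (2, 4), (4, 8)}"
  shows "cayley s ^ k \<in> power_series_mod 0 m"
proof -
  define z where "z = - (fps_X ^ s * inverse (1 + fps_X ^ s) :: rat fps)"
  have "inverse (1 + fps_X ^ s) \<in> power_series_mod 1 m"
    using s by (intro power_series_mod_inverse power_series_mod_add power_series_mod_1
                      power_series_mod_X_power) auto
  hence z: "z \<in> power_series_mod 1 m"
    unfolding z_def
    by (intro power_series_mod_uminus power_series_mod_mult power_series_mod_X_power) auto
  have inv: "(1 + fps_X ^ s) * inverse (1 + fps_X ^ s) = (1 :: rat fps)"
    using s by (intro inverse_mult_eq_1') simp
  have "cayley s = (1 + fps_X ^ s) * inverse (1 + fps_X ^ s) + 2 * z"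
    by (simp add: cayley_def z_def algebra_simps)
  hence cz: "cayley s = 1 + 2 * z" by (simp add: inv)
  define y where "y = z * (z + 1)"
  define t where "t = y * (1 + 2 * y)"
  have two: "2 \<in> power_series_mod 1 m"
    using power_series_mod_of_int[of 2 1 m] by simp
  have y: "y \<in> power_series_mod 1 m"
    unfolding y_def by (intro power_series_mod_mult power_series_mod_add power_series_mod_1 z)
  have t: "t \<in> power_series_mod 1 m"
    unfolding t_def by (intro power_series_mod_mult power_series_mod_add power_series_mod_1 two y)
  have sq: "cayley s ^ 2 = 1 + 4 * y"
    by (simp add: cz y_def algebra_simps power2_eq_square)
  have "cayley s ^ 4 = (cayley s ^ 2) ^ 2" by simp
  also have "\<dots> = 1 + 8 * t"
    unfolding sq by (simp add: t_def algebra_simps power2_eq_square)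
  finally have "cayley s ^ 4 = 1 + 8 * t" .
  with cz sq km have "\<exists>u \<in> power_series_mod 1 m. cayley s ^ k = 1 + of_int m * u"
    using z y t by auto
  thus ?thesis by (auto intro!: power_series_mod_add power_series_mod_1 power_series_mod_of_int_mult)
qed

lemma cayley_cube_power_series_mod:
  assumes "s > 0"
  shows "cayley s ^ 3 \<in> power_series_mod 3 3"
proof -
  have "inverse ((1 + fps_X ^ s) ^ 3) \<in> power_series_mod 3 3"
    using assms
    by (intro power_series_mod_inverse one_plus_X_power_power_series_mod binomial_3_dvd)
       (use assms in \<open>simp_all add: fps_power_zeroth_eq_one\<close>)
  thus ?thesis
    by (auto simp: cayley_def power_mult_distrib fps_inverse_power
             intro!: power_series_mod_mult one_minus_X_power_power_series_mod binomial_3_dvd)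
qed

section \<open>Reduction of the counts to finite products\<close>

text \<open>In the topology of formal power series, convergence means that each coefficient is
  eventually constant.\<close>

lemma nth_prodinf_eventually:
  assumes "\<And>k. int_unit k (f k)"
  shows "\<forall>\<^sub>F N in sequentially. fps_nth (\<Prod>k\<le>N. f k) n = fps_nth (\<Prod>k. f k) n"
proof -
  have "(\<lambda>N. \<Prod>k\<le>N. f k) \<longlonglongrightarrow> (\<Prod>k. f k)"
    using int_unit_prod[OF assms] by (auto simp: has_prod_def raw_has_prod_def int_unit_def)
  thus ?thesis by (auto simp: tendsto_fps_iff)
qed

text \<open>Multiplying the two infinite products that make up the real series involves only
  finitely many of their coefficients, so one partial product serves for all of them, and there
  the factors can be regrouped.\<close>

lemma counts_as_finite_products:
  assumes "complex_curve_counts c" "real_curve_counts (2 * h) w" "-12 \<le> h" "h \<le> 12"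
  obtains N where
    "rat_of_int (c g) = fps_nth (\<Prod>k\<le>N. inverse ((1 - fps_X ^ Suc k) powi 24)) g"
    "rat_of_int (w g) = fps_nth ((\<Prod>k\<le>N. inverse ((1 - fps_X ^ Suc k) powi 24)) *
                             (\<Prod>k\<le>N. cayley (Suc k) ^ nat (12 + h))) g"
proof -
  define A B C :: "nat \<Rightarrow> rat fps" where
    "A = (\<lambda>k. inverse ((1 + fps_X ^ Suc k) powi (2 * h)))" and
    "B = (\<lambda>k. inverse ((1 - fps_X ^ (2 * Suc k)) powi (12 - h)))" and
    "C = (\<lambda>k. inverse ((1 - fps_X ^ Suc k) powi 24))"
  have unit: "int_unit k (A k)" "int_unit k (B k)" "int_unit k (C k)" for k
    unfolding A_def B_def C_def by (rule int_unit_factor; simp)+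
  have "\<forall>\<^sub>F N in sequentially. fps_nth (\<Prod>k\<le>N. C k) g = fps_nth (\<Prod>k. C k) g \<and>
          (\<forall>i\<in>{0..g}. fps_nth (\<Prod>k\<le>N. A k) i = fps_nth (\<Prod>k. A k) i) \<and>
          (\<forall>i\<in>{0..g}. fps_nth (\<Prod>k\<le>N. B k) i = fps_nth (\<Prod>k. B k) i)"
    by (intro eventually_conj eventually_ball_finite ballI nth_prodinf_eventually unit) auto
  then obtain N where N: "fps_nth (\<Prod>k\<le>N. C k) g = fps_nth (\<Prod>k. C k) g"
      "\<And>i. i \<le> g \<Longrightarrow> fps_nth (\<Prod>k\<le>N. A k) i = fps_nth (\<Prod>k. A k) i"
      "\<And>i. i \<le> g \<Longrightarrow> fps_nth (\<Prod>k\<le>N. B k) i = fps_nth (\<Prod>k. B k) i"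
    by (auto simp: eventually_sequentially)
  have half: "(24 - 2 * h) div 2 = 12 - h" by simp
  have "of_int (c g) = fps_nth complex_curves_gf g"
    using assms(1) by (simp add: complex_curve_counts_def fps_eq_iff)
  hence c: "of_int (c g) = fps_nth (\<Prod>k\<le>N. C k) g"
    using N(1) by (simp add: complex_curves_gf_def C_def)
  have "of_int (w g) = fps_nth (real_curves_gf (2 * h)) g"
    using assms(2) by (simp add: real_curve_counts_def fps_eq_iff)
  also have "\<dots> = fps_nth ((\<Prod>k. A k) * (\<Prod>k. B k)) g"
    by (simp only: real_curves_gf_def half A_def B_def)
  also have "\<dots> = fps_nth ((\<Prod>k\<le>N. A k) * (\<Prod>k\<le>N. B k)) g"
    using N(2,3) by (simp add: fps_mult_nth)
  also have "(\<Prod>k\<le>N. A k) * (\<Prod>k\<le>N. B k) = (\<Prod>k\<le>N. C k * cayley (Suc k) ^ nat (12 + h))"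
    unfolding prod.distrib[symmetric] A_def B_def C_def
    using real_factor_eq[OF _ assms(3,4)] by (intro prod.cong refl) (simp only: zero_less_Suc)
  finally have "of_int (w g) = fps_nth ((\<Prod>k\<le>N. C k) * (\<Prod>k\<le>N. cayley (Suc k) ^ nat (12 + h))) g"
    by (simp add: prod.distrib)
  with c show ?thesis using that[of N] by (simp only: C_def)
qed

section \<open>Congruences of the counts\<close>

lemma complex_count_dvd:
  assumes "complex_curve_counts c" "(d, m) \<in> {(8, 2), (4, 4), (2, 8), (3, 3)}" "\<not> d dvd g"
  shows "m dvd c g"
proof -
  \<comment> \<open>The partial products come together with a real series; take Euler characteristic \<open>0\<close>.\<close>
  obtain w where "real_curve_counts (2 * 0) w"
    using ex1_real_curve_counts by blast
  with assms(1) obtain N where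
    N: "rat_of_int (c g) = fps_nth (\<Prod>k\<le>N. inverse ((1 - fps_X ^ Suc k) powi 24)) g"
    by (rule counts_as_finite_products) auto
  have "(\<Prod>k\<le>N. inverse ((1 - fps_X ^ Suc k) powi 24)) \<in> power_series_mod d m"
    by (intro power_series_mod_prod complex_factor_power_series_mod assms(2)) simp
  hence "rat_of_int (c g) \<in> graded_ints d m g"
    unfolding N power_series_mod_def by blast
  thus ?thesis using assms(3) by (simp add: graded_ints_of_int_iff)
qed

text \<open>The product of the corrections is \<open>1 + m t\<close> with \<open>t\<close> integral, so the two series differ by
  \<open>m t\<close> times an integral series.\<close>

lemma real_count_cong_complex_count:
  assumes "complex_curve_counts c" "real_curve_counts (2 * h) w" "-12 \<le> h" "h \<le> 12"
    and km: "(k, m) \<in> {(1, 2), (2, 4), (4, 8)}" and k: "int k dvd 12 + h"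
  shows "[w g = c g] (mod m)"
proof -
  define C :: "nat \<Rightarrow> rat fps" where "C = (\<lambda>k. inverse ((1 - fps_X ^ Suc k) powi 24))"
  define U where "U = (\<lambda>k. cayley (Suc k) ^ nat (12 + h))"
  from assms(1-4) obtain N where N: "of_int (c g) = fps_nth (prod C {..N}) g"
      "of_int (w g) = fps_nth (prod C {..N} * prod U {..N}) g"
    unfolding C_def U_def by (rule counts_as_finite_products)
  have "int k dvd int (nat (12 + h))" using k assms(3) by simp
  then obtain l where l: "nat (12 + h) = k * l" unfolding int_dvd_int_iff by blast
  have "U i \<in> power_series_mod 0 m" for i
    unfolding U_def l power_mult using km by (intro power_series_mod_power cayley_power_cong_1) auto
  hence U: "prod U {..N} \<in> power_series_mod 0 m" by (intro power_series_mod_prod)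
  have U0: "fps_nth (prod U {..N}) 0 = 1"
    by (induction N) (simp_all add: U_def fps_power_zeroth nth_0_cayley)
  have diff: "of_int (w g - c g) = (\<Sum>i=0..g. fps_nth (prod C {..N}) i * fps_nth (prod U {..N} - 1) (g - i))"
  proof -
    have "of_int (w g - c g) = fps_nth (prod C {..N} * prod U {..N} - prod C {..N}) g"
      using N by simp
    also have "prod C {..N} * prod U {..N} - prod C {..N} = prod C {..N} * (prod U {..N} - 1)"
      by (simp add: right_diff_distrib)
    finally show ?thesis by (simp only: fps_mult_nth)
  qed
  \<comment> \<open>Integrality, read off from one of the known congruences of the factors.\<close>
  have C: "prod C {..N} \<in> power_series_mod 1 m"
    unfolding C_def
    by (intro power_series_mod_prod power_series_mod_integral[of _ 8 2]
              complex_factor_power_series_mod) auto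
  have "\<exists>l. fps_nth (prod C {..N}) i * fps_nth (prod U {..N} - 1) j = of_int (m * l)" for i j
  proof -
    have "\<exists>l. fps_nth (prod U {..N} - 1) j = of_int (m * l)"
    proof (cases "j = 0")
      case True
      thus ?thesis using U0 by (intro exI[of _ 0]) simp
    next
      case False
      have "fps_nth (prod U {..N}) j \<in> graded_ints 0 m j"
        using U unfolding power_series_mod_def by blast
      thus ?thesis using False by (auto simp: graded_ints_def dvd_def)
    qed
    then obtain l where l: "fps_nth (prod U {..N} - 1) j = of_int (m * l)" by blast
    obtain l' where "fps_nth (prod C {..N}) i = of_int l'"
      using C by (auto simp: power_series_mod_def graded_ints_def)
    thus ?thesis using l by (intro exI[of _ "l' * l"]) (simp add: mult_ac)
  qed
  then obtain l where l: "\<And>i j. fps_nth (prod C {..N}) i * fps_nth (prod U {..N} - 1) j = of_int (m * l i j)"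
    by metis
  have "(of_int (w g - c g) :: rat) = of_int (\<Sum>i=0..g. m * l i (g - i))"
    unfolding diff l by simp
  hence "w g - c g = m * (\<Sum>i=0..g. l i (g - i))"
    by (simp only: of_int_eq_iff sum_distrib_left)
  thus ?thesis by (simp add: cong_iff_dvd_diff)
qed

text \<open>The exponents \<open>24\<close> and \<open>12 + h\<close> are both multiples of \<open>3\<close>, so modulo \<open>3\<close> every factor is a
  series in \<open>q\<^sup>3\<close>.\<close>

lemma real_count_3_dvd:
  assumes "complex_curve_counts c" "real_curve_counts (2 * h) w" "-12 \<le> h" "h \<le> 12"
    and "3 dvd h" "\<not> 3 dvd g"
  shows "3 dvd w g"
proof -
  from assms(1-4) obtain N where
    N: "rat_of_int (w g) = fps_nth ((\<Prod>k\<le>N. inverse ((1 - fps_X ^ Suc k) powi 24)) *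
                                (\<Prod>k\<le>N. cayley (Suc k) ^ nat (12 + h))) g"
    by (rule counts_as_finite_products)
  have "3 dvd 12 + h" using assms(5) by presburger
  hence "int 3 dvd int (nat (12 + h))" using assms(3) by simp
  then obtain l where l: "nat (12 + h) = 3 * l" unfolding int_dvd_int_iff by blast
  have "(\<Prod>k\<le>N. inverse ((1 - fps_X ^ Suc k) powi 24)) *
          (\<Prod>k\<le>N. cayley (Suc k) ^ nat (12 + h)) \<in> power_series_mod 3 3"
    unfolding l power_mult
    by (intro power_series_mod_mult power_series_mod_prod complex_factor_power_series_mod
              power_series_mod_power cayley_cube_power_series_mod) auto
  hence "rat_of_int (w g) \<in> graded_ints 3 3 g"
    unfolding N power_series_mod_def by blast
  thus ?thesis using assms(6) by (simp add: graded_ints_of_int_iff)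
qed

theorem theorem2p5:
  fixes e :: int and c w :: "nat \<Rightarrow> int"
  assumes "even e" and "-18 \<le> e" and "e \<le> 20"
    and "complex_curve_counts c" and "real_curve_counts e w"
  shows "((\<forall>g\<ge>1. [w g = c g] (mod 2)) \<and>
          (\<forall>g. \<not> [g = 0] (mod 8) \<longrightarrow> [w g = c g] (mod 2) \<and> [c g = 0] (mod 2))) \<and>
         ([e = 0] (mod 4) \<longrightarrow>
          (\<forall>g\<ge>1. [w g = c g] (mod 4) \<and>
            (\<not> [g = 0] (mod 4) \<longrightarrow> [w g = c g] (mod 4) \<and> [c g = 0] (mod 4)))) \<and>
         ([e = 0] (mod 8) \<longrightarrow>
          (\<forall>g\<ge>1. [w g = c g] (mod 8) \<and>
            (\<not> [g = 0] (mod 2) \<longrightarrow> [w g = c g] (mod 8) \<and> [c g = 0] (mod 8)))) \<and>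
         ([e = 0] (mod 3) \<longrightarrow>
          (\<forall>g. \<not> [g = 0] (mod 3) \<longrightarrow> [w g = c g] (mod 3) \<and> [c g = 0] (mod 3)))"
proof -
  obtain h where e: "e = 2 * h" using assms(1) by blast
  have h: "-12 \<le> h" "h \<le> 12" using assms(2,3) by (auto simp: e)
  have w: "real_curve_counts (2 * h) w" using assms(5) by (simp add: e)
  note cong = real_count_cong_complex_count[OF assms(4) w h]
  note dvd = complex_count_dvd[OF assms(4)]
  have two: "[w g = c g] (mod 2)" for g
    by (rule cong[of 1]) auto
  have four: "[w g = c g] (mod 4)" if "[e = 0] (mod 4)" for g
  proof (rule cong[of 2])
    have "4 dvd 2 * h" using that by (simp add: cong_0_iff e)
    thus "int 2 dvd 12 + h" by presburger
  qed auto
  have eight: "[w g = c g] (mod 8)" if "[e = 0] (mod 8)" for g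
  proof (rule cong[of 4])
    have "8 dvd 2 * h" using that by (simp add: cong_0_iff e)
    thus "int 4 dvd 12 + h" by presburger
  qed auto
  have three: "[w g = c g] (mod 3)" if "[e = 0] (mod 3)" "\<not> 3 dvd g" for g
  proof -
    have "3 dvd 2 * h" using that(1) by (simp add: cong_0_iff e)
    hence "3 dvd h" by presburger
    hence "3 dvd w g" using real_count_3_dvd[OF assms(4) w h] that(2) by blast
    moreover have "3 dvd c g" using dvd[of 3 3 g] that(2) by simp
    ultimately show ?thesis by (simp add: cong_iff_dvd_diff)
  qed
  show ?thesis
    using two four eight three dvd[of 8 2] dvd[of 4 4] dvd[of 2 8] dvd[of 3 3]
    by (simp add: cong_0_iff)
qed

end
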